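(* Let $G_n$ ($n\ge1$) be the linear crossed polyomino chain with $n$ four-order complete graphs. Then $$\lim_{n\to\infty}\frac{K\!f^{*}(G_n)}{\mathrm{Gut}(G_n)}=\frac14.$$
   Context: For $n\geq1$, $G_n$ is the simple graph with vertex set $\{1,\ldots,n+1\}\cup\{1',\ldots,(n+1)'\}$ and edge set consisting of the vertical edges $ii'$ for $1\le i\le n+1$ together with, for each $1\le i\le n$, the edges $i(i+1)$, $i'(i+1)'$, $i(i+1)'$, $i'(i+1)$. With $d_u$ the degree of $u$, $d(u,v)$ the shortest-path distance and $r_{uv}$ the effective resistance when every edge is a unit resistor, the Gutman index is $\mathrm{Gut}(G)=\sum_{\{u,v\}}d_ud_v\,d(u,v)$ and the multiplicative degree-Kirchhoff index is $K\!f^*(G)=\sum_{\{u,v\}}d_ud_v r_{uv}$, both summed over unordered pairs of distinct vertices. *)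

theory Defs
  imports "Graph_Theory.Graph_Theory" Complex_Main
begin

text \<open>
  Graphs are finite simple graphs in the sense of locales \<open>graph\<close> and \<open>pair_graph\<close>: an undirected
  edge \<open>uv\<close> is represented by the two opposite arcs \<open>(u,v)\<close> and \<open>(v,u)\<close>. Consequently the degree of
  a vertex is its \<open>out_degree\<close>, and the shortest-path distance is \<open>\<mu>\<close> with all arc weights \<open>1\<close>.
\<close>

definition graph_dist :: "('a,'b) pre_digraph \<Rightarrow> 'a \<Rightarrow> 'a \<Rightarrow> real" where
  "graph_dist G u v = real_of_ereal (wf_digraph.\<mu> G (\<lambda>_. 1) u v)"

text \<open>
  With unit resistors, Ohm's law says that the current through an arc \<open>e\<close> is the potential drop
  \<open>p (tail G e) - p (head G e)\<close>. By Kirchhoff's current law, \<open>p\<close> is a potential for a unit current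
  entering at \<open>u\<close> and leaving at \<open>v\<close> iff the net current out of each vertex \<open>x\<close> is
  \<open>[x = u] - [x = v]\<close>. The effective resistance is the resulting voltage between \<open>u\<close> and \<open>v\<close>; in a
  finite connected graph such a \<open>p\<close> exists and is unique up to an additive constant.
\<close>

definition unit_current_potential ::
    "('a,'b) pre_digraph \<Rightarrow> 'a \<Rightarrow> 'a \<Rightarrow> ('a \<Rightarrow> real) \<Rightarrow> bool" where
  "unit_current_potential G u v p \<longleftrightarrow>
     (\<forall>x \<in> verts G. (\<Sum>e \<in> out_arcs G x. p (tail G e) - p (head G e)) =
        (if x = u then 1 else 0) - (if x = v then 1 else 0))"

definition effective_resistance :: "('a,'b) pre_digraph \<Rightarrow> 'a \<Rightarrow> 'a \<Rightarrow> real" where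
  "effective_resistance G u v = (THE r. \<exists>p. unit_current_potential G u v p \<and> r = p u - p v)"

text \<open>
  The sum of \<open>f u v\<close> over the unordered pairs \<open>{u,v}\<close> of distinct elements of \<open>V\<close>, which is
  meaningful for \<open>f\<close> symmetric on \<open>V\<close>.
\<close>

definition sum_upairs :: "'a set \<Rightarrow> ('a \<Rightarrow> 'a \<Rightarrow> real) \<Rightarrow> real" where
  "sum_upairs V f = (\<Sum>P | P \<subseteq> V \<and> card P = 2. THE c. \<exists>u v. P = {u, v} \<and> c = f u v)"

lemma sum_upairs_eq_half_sum:
  assumes fin: "finite V"
    and sym: "\<And>u v. u \<in> V \<Longrightarrow> v \<in> V \<Longrightarrow> f u v = f v u"
  shows "sum_upairs V f = (\<Sum>(u, v) | u \<in> V \<and> v \<in> V \<and> u \<noteq> v. f u v) / 2"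
proof -
  let ?S = "{(u, v). u \<in> V \<and> v \<in> V \<and> u \<noteq> v}"
  let ?T = "{P. P \<subseteq> V \<and> card P = 2}"
  let ?h = "\<lambda>(u, v). {u, v}"
  have finS: "finite ?S"
    by (rule finite_subset[of _ "V \<times> V"]) (use fin in auto)
  have finT: "finite ?T"
    using fin by simp
  have img: "?h ` ?S \<subseteq> ?T"
    by auto
  have inner: "(\<Sum>x \<in> {x \<in> ?S. ?h x = P}. case x of (u, v) \<Rightarrow> f u v)
      = 2 * (THE c. \<exists>u v. P = {u, v} \<and> c = f u v)" if P: "P \<in> ?T" for P
  proof -
    obtain a b where ab: "P = {a, b}" "a \<noteq> b"
      using P by (auto simp: card_2_iff)
    have V: "a \<in> V" "b \<in> V"
      using P ab by auto
    have "(THE c. \<exists>u v. P = {u, v} \<and> c = f u v) = f a b"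
    proof (rule the_equality)
      show "\<exists>u v. P = {u, v} \<and> f a b = f u v"
        using ab by blast
      show "c = f a b" if c: "\<exists>u v. P = {u, v} \<and> c = f u v" for c
      proof -
        obtain u v where uv: "P = {u, v}" "c = f u v"
          using c by blast
        have "u = a \<and> v = b \<or> u = b \<and> v = a"
          using uv(1) ab by (auto simp: doubleton_eq_iff)
        thus ?thesis
          using uv(2) sym[OF V] by auto
      qed
    qed
    moreover have "{x \<in> ?S. ?h x = P} = {(a, b), (b, a)}"
      using ab V by (auto simp: doubleton_eq_iff)
    ultimately show ?thesis
      using ab(2) sym[OF V] by simp
  qed
  have "(\<Sum>x \<in> ?S. case x of (u, v) \<Rightarrow> f u v)
      = (\<Sum>P \<in> ?T. \<Sum>x \<in> {x \<in> ?S. ?h x = P}. case x of (u, v) \<Rightarrow> f u v)"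
    by (rule sum.group[OF finS finT img, symmetric])
  also have "\<dots> = 2 * sum_upairs V f"
    unfolding sum_upairs_def sum_distrib_left using inner by (intro sum.cong) auto
  finally show ?thesis
    by simp
qed

definition gutman_index :: "('a,'b) pre_digraph \<Rightarrow> real" where
  "gutman_index G = sum_upairs (verts G)
     (\<lambda>u v. real (out_degree G u) * real (out_degree G v) * graph_dist G u v)"

definition mult_degree_kirchhoff_index :: "('a,'b) pre_digraph \<Rightarrow> real" where
  "mult_degree_kirchhoff_index G = sum_upairs (verts G)
     (\<lambda>u v. real (out_degree G u) * real (out_degree G v) * effective_resistance G u v)"

text \<open>The vertex \<open>i\<close> is encoded as \<open>(i, False)\<close> and the primed vertex \<open>i'\<close> as \<open>(i, True)\<close>.\<close>

definition crossed_chain_edges :: "nat \<Rightarrow> ((nat \<times> bool) \<times> (nat \<times> bool)) set" where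
  "crossed_chain_edges n =
     (\<Union>i \<in> {1..n + 1}. {((i, False), (i, True))}) \<union>
     (\<Union>i \<in> {1..n}. {((i, False), (i + 1, False)), ((i, True), (i + 1, True)),
                    ((i, False), (i + 1, True)), ((i, True), (i + 1, False))})"

definition crossed_chain :: "nat \<Rightarrow> (nat \<times> bool) pair_pre_digraph" where
  "crossed_chain n =
     \<lparr> pverts = {1..n + 1} \<times> UNIV,
       parcs = crossed_chain_edges n \<union> (crossed_chain_edges n)\<inverse> \<rparr>"

lemma pair_graph_crossed_chain: "pair_graph (crossed_chain n)"
proof
  show "finite (parcs (crossed_chain n))"
    by (auto simp: crossed_chain_def crossed_chain_edges_def)
  show "symmetric (with_proj (crossed_chain n))"
    unfolding symmetric_def arcs_ends_def arc_to_ends_def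
    by (auto simp: crossed_chain_def with_proj_def intro!: symI)
qed (auto simp: crossed_chain_def crossed_chain_edges_def)

end

(* Consecutive levels {i, i'} and {i+1, (i+1)'} are joined by four parallel edges. The swap symmetry
   at each level splits a unit current from (i, b) to (j, c) into a symmetric part, which drops by
   1/4 per level, and an antisymmetric part, which is supported on the levels i and j. Hence the
   resistance is d(u, v)/4 up to at most 1/4. As the degrees lie between 3 and 5, this makes
   Kf* - Gut/4 of order n^2, whereas Gut is of order n^3. *)
theory Submission
  imports Defs "HOL-Real_Asymp.Real_Asymp"
begin

section \<open>Adjacency, neighbour sums and degrees\<close>

lemma parcs_crossed_chain_iff:
  "((i, b), (j, c)) \<in> parcs (crossed_chain n) \<longleftrightarrow>
     i \<in> {1..n + 1} \<and> j \<in> {1..n + 1} \<and> (i = j \<and> b \<noteq> c \<or> j = i + 1 \<or> i = j + 1)"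
  unfolding crossed_chain_def crossed_chain_edges_def
  by (cases b; cases c; auto)

lemma pverts_crossed_chain: "pverts (crossed_chain n) = {1..n + 1} \<times> UNIV"
  by (simp add: crossed_chain_def)

lemma wf_digraph_crossed_chain: "wf_digraph (with_proj (crossed_chain n))"
  by unfold_locales (auto simp: parcs_crossed_chain_iff pverts_crossed_chain)

text \<open>One formula serves two purposes: with \<open>f\<close> constantly 1 it counts degrees,
  and with \<open>f\<close> a potential drop it gives the left-hand side of Kirchhoff's law.\<close>

lemma sum_out_arcs_crossed_chain:
  fixes f :: "_ \<Rightarrow> 'a::comm_monoid_add"
  assumes "k \<in> {1..n + 1}"
  shows "(\<Sum>e \<in> out_arcs (with_proj (crossed_chain n)) (k, c). f (snd e)) =
     f (k, \<not> c) + (if 1 < k then f (k - 1, True) + f (k - 1, False) else 0)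
                + (if k \<le> n then f (k + 1, True) + f (k + 1, False) else 0)"
proof -
  let ?N = "{(k, \<not> c)} \<union> (if 1 < k then {(k - 1, True), (k - 1, False)} else {})
     \<union> (if k \<le> n then {(k + 1, True), (k + 1, False)} else {})"
  have N: "(j, d) \<in> ?N \<longleftrightarrow> j \<in> {1..n + 1} \<and> (k = j \<and> c \<noteq> d \<or> j = k + 1 \<or> k = j + 1)" for j d
    using assms by (cases c; cases d; cases "1 < k"; cases "k \<le> n"; simp; arith)
  have "e \<in> out_arcs (with_proj (crossed_chain n)) (k, c) \<longleftrightarrow> e \<in> Pair (k, c) ` ?N" for e
  proof -
    obtain x j d where e: "e = (x, (j, d))" by (metis surj_pair)
    have "e \<in> out_arcs (with_proj (crossed_chain n)) (k, c) \<longleftrightarrow>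
        x = (k, c) \<and> ((k, c), (j, d)) \<in> parcs (crossed_chain n)"
      by (auto simp: out_arcs_def e)
    also have "\<dots> \<longleftrightarrow> x = (k, c) \<and> (j, d) \<in> ?N"
      unfolding parcs_crossed_chain_iff N using assms by blast
    also have "\<dots> \<longleftrightarrow> e \<in> Pair (k, c) ` ?N"
      unfolding e image_iff by blast
    finally show ?thesis .
  qed
  then have out: "out_arcs (with_proj (crossed_chain n)) (k, c) = Pair (k, c) ` ?N"
    by blast
  have reindex: "(\<Sum>e \<in> Pair (k, c) ` N. f (snd e)) = sum f N" for N
    by (simp add: sum.reindex inj_on_def)
  \<comment> \<open>Splitting the sum over \<open>?N\<close> needs the listed neighbours to be
    distinct, which truncated subtraction on \<open>nat\<close> does not give for free.\<close>
  have "k - 1 \<noteq> k" if "1 < k" using that by simp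
  have "(\<Sum>e \<in> out_arcs (with_proj (crossed_chain n)) (k, c). f (snd e)) = sum f ?N"
    by (simp only: out reindex)
  also have "\<dots> = f (k, \<not> c) + (if 1 < k then f (k - 1, True) + f (k - 1, False) else 0)
                + (if k \<le> n then f (k + 1, True) + f (k + 1, False) else 0)"
    using \<open>1 < k \<Longrightarrow> k - 1 \<noteq> k\<close> by (cases "1 < k"; cases "k \<le> n") (simp_all add: add_ac)
  finally show ?thesis .
qed

lemma out_degree_crossed_chain:
  assumes "k \<in> {1..n + 1}"
  shows "out_degree (with_proj (crossed_chain n)) (k, c) =
     1 + (if 1 < k then 2 else 0) + (if k \<le> n then 2 else 0)"
  using sum_out_arcs_crossed_chain[OF assms, of "\<lambda>_. 1::nat" c] by (simp add: out_degree_def)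

text \<open>End levels have degree 3 and inner levels degree 5. For \<open>n = 0\<close> the only
  level would have degree 1.\<close>

lemma out_degree_crossed_chain_bounds:
  assumes "n \<ge> 1" "u \<in> {1..n + 1} \<times> UNIV"
  shows "real (out_degree (with_proj (crossed_chain n)) u) \<in> {3..5}"
  using assms by (cases u) (auto simp: out_degree_crossed_chain)

section \<open>Distances\<close>

text \<open>An arc changes the level by at most 1.\<close>

lemma awalk_crossed_chain_length_ge:
  assumes "pre_digraph.awalk (with_proj (crossed_chain n)) u p v"
  shows "\<bar>real (fst u) - real (fst v)\<bar> \<le> real (length p)"
proof -
  interpret wf_digraph "with_proj (crossed_chain n)" by (rule wf_digraph_crossed_chain)
  show ?thesis
    using assms
  proof (induction p arbitrary: u)
    case (Cons e p)
    obtain i b j c where e: "e = ((i, b), (j, c))" by (metis surj_pair)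
    from Cons.prems have "((i, b), (j, c)) \<in> parcs (crossed_chain n)" "u = (i, b)"
      "awalk (j, c) p v"
      by (auto simp: awalk_Cons_iff e)
    then show ?case using Cons.IH[of "(j, c)"] by (auto simp: parcs_crossed_chain_iff)
  qed (auto simp: awalk_Nil_iff)
qed

text \<open>The walk stays on side \<open>b\<close> while moving towards \<open>j\<close>. Since
  consecutive levels are completely joined, its last arc can end on either side, so \<open>c\<close>
  costs nothing once there is at least one step; hence the form \<open>Suc m\<close>.\<close>

lemma awalk_crossed_chain_exists:
  assumes "\<bar>int i - int j\<bar> = int (Suc m)" "i \<in> {1..n + 1}" "j \<in> {1..n + 1}"
  shows "\<exists>p. pre_digraph.awalk (with_proj (crossed_chain n)) (i, b) p (j, c) \<and>
             real (length p) = real (Suc m)"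
proof -
  interpret wf_digraph "with_proj (crossed_chain n)" by (rule wf_digraph_crossed_chain)
  show ?thesis
    using assms
  proof (induction m arbitrary: i)
    case 0
    then show ?case
      by (intro exI[of _ "[((i, b), (j, c))]"])
        (auto simp: awalk_simps parcs_crossed_chain_iff pverts_crossed_chain)
  next
    case (Suc m)
    define i' where "i' = (if i < j then i + 1 else i - 1)"
    have i': "\<bar>int i' - int j\<bar> = int (Suc m)" "i' \<in> {1..n + 1}"
      "((i, b), (i', b)) \<in> parcs (crossed_chain n)"
      using Suc.prems by (auto simp: i'_def parcs_crossed_chain_iff)
    from Suc.IH[OF i'(1,2) Suc.prems(3)] obtain p
      where "awalk (i', b) p (j, c)" "real (length p) = real (Suc m)" by blast
    then show ?case using i'(3)
      by (intro exI[of _ "((i, b), (i', b)) # p"]) (auto simp: awalk_simps)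
  qed
qed

text \<open>The \<open>max 1\<close> covers the two vertices of one level: they are adjacent
  although their levels agree.\<close>

lemma graph_dist_crossed_chain:
  assumes "u \<in> {1..n + 1} \<times> UNIV" "v \<in> {1..n + 1} \<times> UNIV" "u \<noteq> v"
  shows "graph_dist (with_proj (crossed_chain n)) u v = max 1 \<bar>real (fst u) - real (fst v)\<bar>"
proof -
  interpret wf_digraph "with_proj (crossed_chain n)" by (rule wf_digraph_crossed_chain)
  obtain i b j c where uv: "u = (i, b)" "v = (j, c)" by (metis surj_pair)
  let ?d = "max 1 \<bar>real (fst u) - real (fst v)\<bar>"
  have lower: "?d \<le> real (length p)" if p: "awalk u p v" for p
  proof -
    have "p \<noteq> []" using p assms(3) by (auto simp: awalk_Nil_iff)
    then have "1 \<le> real (length p)"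
      by (cases p) simp_all
    then show ?thesis using awalk_crossed_chain_length_ge[OF p] by simp
  qed
  have "\<exists>p. awalk u p v \<and> real (length p) = ?d"
  proof (cases "i = j")
    case True
    then show ?thesis using assms uv
      by (intro exI[of _ "[(u, v)]"])
        (auto simp: awalk_simps parcs_crossed_chain_iff pverts_crossed_chain)
  next
    case False
    define m where "m = nat (\<bar>int i - int j\<bar> - 1)"
    have m: "\<bar>int i - int j\<bar> = int (Suc m)" using False by (auto simp: m_def)
    have "?d = real (Suc m)" using m uv by auto
    then show ?thesis using awalk_crossed_chain_exists[OF m] assms uv by simp
  qed
  then obtain p where p: "awalk u p v" "real (length p) = ?d" by blast
  have "\<mu> (\<lambda>_. 1) u v = ereal ?d"
  proof (rule antisym)
    show "\<mu> (\<lambda>_. 1) u v \<le> ereal ?d" using min_cost_le_walk_cost[OF p(1), of "\<lambda>_. 1"] p(2)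
      by (simp add: awalk_cost_def sum_list_triv)
    show "ereal ?d \<le> \<mu> (\<lambda>_. 1) u v"
      unfolding \<mu>_def using lower by (intro INF_greatest) (auto simp: awalk_cost_def sum_list_triv)
  qed
  then show ?thesis by (simp only: graph_dist_def real_of_ereal.simps)
qed

section \<open>Resistances\<close>

lemma unit_current_potential_crossed_chain_iff:
  "unit_current_potential (with_proj (crossed_chain n)) u v p \<longleftrightarrow>
     (\<forall>k \<in> {1..n + 1}. \<forall>c. (p (k, c) - p (k, \<not> c))
        + (if 1 < k then 2 * p (k, c) - p (k - 1, True) - p (k - 1, False) else 0)
        + (if k \<le> n then 2 * p (k, c) - p (k + 1, True) - p (k + 1, False) else 0) =
      (if (k, c) = u then 1 else 0) - (if (k, c) = v then 1 else 0))"
proof -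
  let ?G = "with_proj (crossed_chain n)"
  have "(\<Sum>e \<in> out_arcs ?G (k, c). p (tail ?G e) - p (head ?G e)) =
      (p (k, c) - p (k, \<not> c))
        + (if 1 < k then 2 * p (k, c) - p (k - 1, True) - p (k - 1, False) else 0)
        + (if k \<le> n then 2 * p (k, c) - p (k + 1, True) - p (k + 1, False) else 0)"
    if "k \<in> {1..n + 1}" for k c
  proof -
    have "(\<Sum>e \<in> out_arcs ?G (k, c). p (tail ?G e) - p (head ?G e)) =
        (\<Sum>e \<in> out_arcs ?G (k, c). (\<lambda>y. p (k, c) - p y) (snd e))"
      by (intro sum.cong) auto
    then show ?thesis by (subst (asm) sum_out_arcs_crossed_chain[OF that]) auto
  qed
  then show ?thesis
    by (auto simp: unit_current_potential_def pverts_crossed_chain)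
qed

text \<open>
  Subtracting the equations at \<open>(k, True)\<close> and \<open>(k, False)\<close> gives \<open>q (k, True) = q (k, False)\<close>;
  then the equations at \<open>(k, True)\<close> determine the levels successively.
\<close>

lemma crossed_chain_harmonic_const:
  fixes q :: "nat \<times> bool \<Rightarrow> real"
  assumes harm: "\<And>k c. k \<in> {1..n + 1} \<Longrightarrow> (q (k, c) - q (k, \<not> c))
        + (if 1 < k then 2 * q (k, c) - q (k - 1, True) - q (k - 1, False) else 0)
        + (if k \<le> n then 2 * q (k, c) - q (k + 1, True) - q (k + 1, False) else 0) = 0"
    and u: "u \<in> {1..n + 1} \<times> UNIV"
  shows "q u = q (1, True)"
proof -
  have sym: "q (k, True) = q (k, False)" if "k \<in> {1..n + 1}" for k
    using harm[OF that, of True] harm[OF that, of False] by (auto split: if_splits)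
  have step: "q (Suc k, True) = q (k, True)" if "k \<in> {1..n}" for k
    using that
  proof (induction k)
    case (Suc k)
    \<comment> \<open>Level 1 has no lower neighbours, so its equation alone equates levels 1 and 2.
      Higher up, the induction hypothesis makes the drop to the level below vanish, and the equation
      then equates the level with the next one.\<close>
    show ?case
    proof (cases "k = 0")
      case True
      then show ?thesis using harm[of 1 True] sym[of 1] sym[of 2] Suc.prems
        by (simp add: numeral_2_eq_2)
    next
      case False
      then show ?thesis
        using harm[of "Suc k" True] sym[of "Suc k"] sym[of k] sym[of "Suc (Suc k)"] Suc by simp
    qed
  qed simp
  have const: "q (k, True) = q (1, True)" if "1 \<le> k" "k \<le> n + 1" for k
    using that by (induction k rule: dec_induct) (simp_all add: step)
  obtain k c where kc: "u = (k, c)" by fastforce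
  with u have "k \<in> {1..n + 1}" by blast
  then have "q (k, True) = q (1, True)" "q (k, False) = q (1, True)"
    using const[of k] sym[of k] by simp_all
  then show ?thesis unfolding kc by (cases c) simp_all
qed

text \<open>\<open>THE\<close> requires a unique voltage. The difference of two potentials for the
  same current solves the homogeneous equations, so it is constant and both drops agree. One
  explicit potential then suffices.\<close>

lemma effective_resistance_crossed_chain_eqI:
  assumes p: "unit_current_potential (with_proj (crossed_chain n)) u v p"
    and uv: "u \<in> {1..n + 1} \<times> UNIV" "v \<in> {1..n + 1} \<times> UNIV"
  shows "effective_resistance (with_proj (crossed_chain n)) u v = p u - p v"
  unfolding effective_resistance_def
proof (rule the_equality)
  fix r assume "\<exists>p. unit_current_potential (with_proj (crossed_chain n)) u v p \<and> r = p u - p v"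
  then obtain p' where p': "unit_current_potential (with_proj (crossed_chain n)) u v p'"
    and r: "r = p' u - p' v" by blast
  define q where "q x = p' x - p x" for x
  have "(q (k, c) - q (k, \<not> c))
        + (if 1 < k then 2 * q (k, c) - q (k - 1, True) - q (k - 1, False) else 0)
        + (if k \<le> n then 2 * q (k, c) - q (k + 1, True) - q (k + 1, False) else 0) = 0"
    if "k \<in> {1..n + 1}" for k c
    using p[unfolded unit_current_potential_crossed_chain_iff, rule_format, OF that, of c]
      p'[unfolded unit_current_potential_crossed_chain_iff, rule_format, OF that, of c]
    unfolding q_def by (cases "1 < k"; cases "k \<le> n"; simp)
  then have "q u = q (1, True)" "q v = q (1, True)"
    using crossed_chain_harmonic_const uv by metis+
  then show "r = p u - p v" by (simp add: q_def r)
qed (use p in blast)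

text \<open>The first summand is the symmetric drop, the other two come from the antisymmetric part
  at the levels \<open>i\<close> and \<open>j\<close>. If the levels coincide, the antisymmetric
  sources cancel (\<open>s = 1\<close>) or reinforce each other (\<open>s = -1\<close>).\<close>

lemma effective_resistance_crossed_chain:
  fixes b c :: bool
  assumes i: "i \<in> {1..n + 1}" and j: "j \<in> {1..n + 1}"
  defines "D \<equiv> \<lambda>k. real (out_degree (with_proj (crossed_chain n)) (k, True)) + 1"
    and "s \<equiv> if i = j then (if b = c then 1 else - 1) else (0::real)"
  shows "effective_resistance (with_proj (crossed_chain n)) (i, b) (j, c) =
     \<bar>real i - real j\<bar> / 4 + (1 - s) / (2 * D i) + (1 - s) / (2 * D j)"
proof -
  \<comment> \<open>\<open>S\<close> has constant slope between the levels \<open>i\<close> and \<open>j\<close> and is constant outside; writing it with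
    absolute values makes the boundary terms vanish and avoids assuming \<open>i \<le> j\<close>.\<close>
  define S where "S k = (\<bar>real k - real j\<bar> - \<bar>real k - real i\<bar>) / 8" for k
  \<comment> \<open>Half of the unit at \<open>(i, b)\<close> is injected antisymmetrically: 1/2
    there and -1/2 at its twin; likewise with opposite sign at \<open>j\<close>. Division by
    \<open>D k\<close> inverts the Kirchhoff operator on antisymmetric functions.\<close>
  define A where "A k x = ((if k = i then (if x = b then 1 else - 1) else 0)
      - (if k = j then (if x = c then 1 else - 1) else 0)) / (2 * D k)" for k x
  define p where "p x = S (fst x) + A (fst x) (snd x)" for x
  have A_neg: "A k (\<not> x) = - A k x" for k x
    by (auto simp: A_def)
  have A_sum: "A k True + A k False = 0" for k
    using A_neg[of k True] by simp
  have potential: "unit_current_potential (with_proj (crossed_chain n)) (i, b) (j, c) p"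
    unfolding unit_current_potential_crossed_chain_iff
  proof (intro ballI allI)
    fix k x assume k: "k \<in> {1..n + 1}"
    have D: "D k = 2 + (if 1 < k then 2 else 0) + (if k \<le> n then 2 else 0)"
      using out_degree_crossed_chain[OF k, of True] by (simp add: D_def)
    then have "D k > 0" by simp
    \<comment> \<open>In the \<open>A\<close> part the two values on each neighbouring level cancel.
      The vertical edge contributes twice \<open>A k x\<close> and every other edge contributes it
      once, which makes degree plus one, that is \<open>D k\<close>.\<close>
    have "(p (k, x) - p (k, \<not> x))
        + (if 1 < k then 2 * p (k, x) - p (k - 1, True) - p (k - 1, False) else 0)
        + (if k \<le> n then 2 * p (k, x) - p (k + 1, True) - p (k + 1, False) else 0)
      = D k * A k x + (if 1 < k then 2 * (S k - S (k - 1)) else 0)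
        + (if k \<le> n then 2 * (S k - S (k + 1)) else 0)"
      unfolding D p_def fst_conv snd_conv A_neg
      using A_sum[of "k - 1"] A_sum[of "k + 1"] by (auto simp: algebra_simps)
    also have "(if 1 < k then 2 * (S k - S (k - 1)) else 0)
        = 2 * (S k - (\<bar>real k - 1 - real j\<bar> - \<bar>real k - 1 - real i\<bar>) / 8)"
      using k i j by (auto simp: S_def)
    also have "(if k \<le> n then 2 * (S k - S (k + 1)) else 0)
        = 2 * (S k - (\<bar>real k + 1 - real j\<bar> - \<bar>real k + 1 - real i\<bar>) / 8)"
      using k i j by (auto simp: S_def add_ac)
    also have "D k * A k x + 2 * (S k - (\<bar>real k - 1 - real j\<bar> - \<bar>real k - 1 - real i\<bar>) / 8)
        + 2 * (S k - (\<bar>real k + 1 - real j\<bar> - \<bar>real k + 1 - real i\<bar>) / 8)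
      = D k * A k x + ((if k = i then 1 else 0) - (if k = j then 1 else 0)) / 2"
    proof -
      \<comment> \<open>The second difference of the absolute value is 2 at its kink and 0
        elsewhere; the factors 1/8 and 2 turn this into the symmetric source 1/2.\<close>
      have lap: "\<bar>real k - 1 - real l\<bar> + \<bar>real k + 1 - real l\<bar> - 2 * \<bar>real k - real l\<bar>
          = (if k = l then 2 else 0)" for l
        by (cases k l rule: linorder_cases) auto
      show ?thesis using lap[of i] lap[of j] unfolding S_def by (auto simp: field_simps)
    qed
    also have "D k * A k x = ((if k = i then (if x = b then 1 else - 1) else 0)
      - (if k = j then (if x = c then 1 else - 1) else 0)) / 2"
      using \<open>D k > 0\<close> by (simp add: A_def)
    also have "\<dots> + ((if k = i then 1 else 0) - (if k = j then 1 else 0)) / 2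
       = (if (k, x) = (i, b) then 1 else 0) - (if (k, x) = (j, c) then 1 else (0::real))"
      by (cases "k = i"; cases "k = j"; cases "x = b"; cases "x = c"; simp)
    finally show "(p (k, x) - p (k, \<not> x))
        + (if 1 < k then 2 * p (k, x) - p (k - 1, True) - p (k - 1, False) else 0)
        + (if k \<le> n then 2 * p (k, x) - p (k + 1, True) - p (k + 1, False) else 0)
       = (if (k, x) = (i, b) then 1 else 0) - (if (k, x) = (j, c) then 1 else 0)" .
  qed
  have "effective_resistance (with_proj (crossed_chain n)) (i, b) (j, c) = p (i, b) - p (j, c)"
    using i j by (intro effective_resistance_crossed_chain_eqI[OF potential]) auto
  also have "\<dots> = \<bar>real i - real j\<bar> / 4 + (1 - s) / (2 * D i) + (1 - s) / (2 * D j)"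
    by (cases "i = j"; cases "b = c") (simp_all add: p_def S_def A_def s_def abs_minus_commute)
  finally show ?thesis .
qed

lemma effective_resistance_crossed_chain_commute:
  assumes "u \<in> {1..n + 1} \<times> UNIV" "v \<in> {1..n + 1} \<times> UNIV"
  shows "effective_resistance (with_proj (crossed_chain n)) u v =
    effective_resistance (with_proj (crossed_chain n)) v u"
  using assms
  by (cases u; cases v) (auto simp: effective_resistance_crossed_chain abs_minus_commute)

text \<open>For \<open>n >= 1\<close>, degree plus one is 4 or 6. On different levels the excess is
  a sum of two terms of at most 1/8. On one level the distance is 1 and the resistance is 1/2 or
  1/3.\<close>

lemma effective_resistance_crossed_chain_bounds:
  assumes "n \<ge> 1" "u \<in> {1..n + 1} \<times> UNIV" "v \<in> {1..n + 1} \<times> UNIV" "u \<noteq> v"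
  shows "effective_resistance (with_proj (crossed_chain n)) u v
     - graph_dist (with_proj (crossed_chain n)) u v / 4 \<in> {0..1 / 4}"
proof -
  obtain i b j c where uv: "u = (i, b)" "v = (j, c)" by (metis surj_pair)
  have d: "graph_dist (with_proj (crossed_chain n)) u v = max 1 \<bar>real i - real j\<bar>"
    using graph_dist_crossed_chain[of u n v] assms uv by simp
  have ij: "i \<in> {1..n + 1}" "j \<in> {1..n + 1}" using assms uv by auto
  show ?thesis
  proof (cases "i = j")
    case True
    then show ?thesis using assms(1,4) ij d unfolding uv
      by (auto simp: effective_resistance_crossed_chain out_degree_crossed_chain)
  next
    case False
    then have "max 1 \<bar>real i - real j\<bar> = \<bar>real i - real j\<bar>" by auto
    with False show ?thesis using assms(1) ij d unfolding uv
      by (auto simp: effective_resistance_crossed_chain out_degree_crossed_chain)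
  qed
qed

section \<open>The limit\<close>

text \<open>The step from \<open>m\<close> to \<open>Suc m\<close> adds a row and a column, each
  with sum 1 + ... + m, and a zero corner.\<close>

lemma sum_abs_diff_atLeastAtMost:
  "(\<Sum>i = 1..m. \<Sum>j = 1..m. \<bar>real i - real j\<bar>) = (real m ^ 3 - real m) / 3"
proof (induction m)
  case (Suc m)
  have row: "(\<Sum>j = 1..m. \<bar>real (Suc m) - real j\<bar>) = real m * (real m + 1) / 2"
  proof -
    have "(\<Sum>j = 1..m. \<bar>real (Suc m) - real j\<bar>) = (\<Sum>j = 1..m. real (Suc m) - real j)"
      by (intro sum.cong) auto
    also have "\<dots> = real m * (real m + 1) - (\<Sum>j = 1..m. real j)"
      by (simp add: sum_subtractf algebra_simps)
    also have "(\<Sum>j = 1..m. real j) = real m * (real m + 1) / 2"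
      by (induction m) (auto simp: field_simps)
    finally show ?thesis by simp
  qed
  then have col: "(\<Sum>i = 1..m. \<bar>real i - real (Suc m)\<bar>) = real m * (real m + 1) / 2"
    by (simp add: abs_minus_commute)
  have split: "(\<Sum>i = 1..Suc m. \<Sum>j = 1..Suc m. g i j) = (\<Sum>i = 1..m. \<Sum>j = 1..m. g i j)
      + (\<Sum>i = 1..m. g i (Suc m)) + (\<Sum>j = 1..m. g (Suc m) j) + g (Suc m) (Suc m)"
    for g :: "nat \<Rightarrow> nat \<Rightarrow> real"
    by (simp add: sum.distrib)
  show ?case
    unfolding split Suc.IH row col by (simp add: power3_eq_cube field_simps)
qed simp

lemma gutman_index_crossed_chain_eq:
  fixes n
  defines "G \<equiv> with_proj (crossed_chain n)" and "V \<equiv> {1..n + 1} \<times> (UNIV :: bool set)"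
  shows "gutman_index G = (\<Sum>(u, v) | u \<in> V \<and> v \<in> V \<and> u \<noteq> v.
     real (out_degree G u) * real (out_degree G v) * graph_dist G u v) / 2"
  unfolding gutman_index_def G_def V_def with_proj_simps pverts_crossed_chain
proof (rule sum_upairs_eq_half_sum)
  let ?G = "with_proj (crossed_chain n)"
  fix u v assume "u \<in> {1..n + 1} \<times> (UNIV :: bool set)" "v \<in> {1..n + 1} \<times> (UNIV :: bool set)"
  then show "real (out_degree ?G u) * real (out_degree ?G v) * graph_dist ?G u v
     = real (out_degree ?G v) * real (out_degree ?G u) * graph_dist ?G v u"
    \<comment> \<open>The distance formula covers distinct vertices only.\<close>
    by (cases "u = v") (simp_all add: graph_dist_crossed_chain abs_minus_commute)
qed simp

text \<open>Degree products are at least 9 and distances at least the level difference. Each ordered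
  pair of levels carries 4 ordered pairs of vertices, so halving leaves 18 times the sum of level
  differences.\<close>

lemma gutman_index_crossed_chain_ge:
  assumes "n \<ge> 1"
  shows "gutman_index (with_proj (crossed_chain n)) \<ge> 6 * (real (n + 1) ^ 3 - real (n + 1))"
proof -
  let ?G = "with_proj (crossed_chain n)"
  let ?V = "{1..n + 1} \<times> (UNIV :: bool set)"
  let ?S = "{(u, v). u \<in> ?V \<and> v \<in> ?V \<and> u \<noteq> v}"
  let ?l = "\<lambda>u v :: nat \<times> bool. \<bar>real (fst u) - real (fst v)\<bar>"
  have sum_levels: "(\<Sum>u \<in> ?V. h (fst u)) = 2 * (\<Sum>i = 1..n + 1. h i)" for h :: "nat \<Rightarrow> real"
  proof -
    have "(\<Sum>u \<in> ?V. h (fst u)) = (\<Sum>i = 1..n + 1. \<Sum>b \<in> (UNIV :: bool set). h i)"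
      by (simp only: sum.cartesian_product case_prod_unfold)
    then show ?thesis by (simp add: sum_distrib_left)
  qed
  have "gutman_index ?G =
      (\<Sum>(u, v) \<in> ?S. real (out_degree ?G u) * real (out_degree ?G v) * graph_dist ?G u v) / 2"
    by (rule gutman_index_crossed_chain_eq)
  also have "\<dots> \<ge> (\<Sum>(u, v) \<in> ?S. 9 * ?l u v) / 2"
  proof (intro divide_right_mono sum_mono)
    fix x assume "x \<in> ?S"
    then obtain u v where x: "x = (u, v)" "u \<in> ?V" "v \<in> ?V" "u \<noteq> v" by blast
    have "3 * 3 \<le> real (out_degree ?G u) * real (out_degree ?G v)"
      using out_degree_crossed_chain_bounds[OF assms x(2)]
        out_degree_crossed_chain_bounds[OF assms x(3)] by (intro mult_mono) auto
    then have "9 * ?l u v \<le> real (out_degree ?G u) * real (out_degree ?G v) * graph_dist ?G u v"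
      using x by (intro mult_mono) (auto simp: graph_dist_crossed_chain)
    then show "(case x of (u, v) \<Rightarrow> 9 * ?l u v) \<le>
      (case x of (u, v) \<Rightarrow> real (out_degree ?G u) * real (out_degree ?G v) * graph_dist ?G u v)"
      by (simp add: x)
  qed simp
  \<comment> \<open>The diagonal may be added because its terms are 0.\<close>
  also have "(\<Sum>(u, v) \<in> ?S. 9 * ?l u v) = (\<Sum>(u, v) \<in> ?V \<times> ?V. 9 * ?l u v)"
    by (rule sum.mono_neutral_left) auto
  also have "\<dots> = (\<Sum>u \<in> ?V. \<Sum>v \<in> ?V. 9 * ?l u v)"
    by (simp only: sum.cartesian_product)
  also have "\<dots> = 2 * (\<Sum>i = 1..n + 1. 2 * (\<Sum>j = 1..n + 1. 9 * \<bar>real i - real j\<bar>))"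
    by (simp only: sum_levels[of "\<lambda>j. 9 * \<bar>real i - real j\<bar>" for i]
        sum_levels[of "\<lambda>i. 2 * (\<Sum>j = 1..n + 1. 9 * \<bar>real i - real j\<bar>)"])
  also have "\<dots> = 36 * (\<Sum>i = 1..n + 1. \<Sum>j = 1..n + 1. \<bar>real i - real j\<bar>)"
    unfolding sum_distrib_left by simp
  finally show ?thesis unfolding sum_abs_diff_atLeastAtMost by simp
qed

text \<open>Each ordered pair contributes between 0 and 5 * 5 * 1/4, and there are at most
  \<open>4 * (n + 1)^2\<close> of them; halving gives the constant 25/2.\<close>

lemma mult_degree_kirchhoff_index_crossed_chain_bounds:
  assumes "n \<ge> 1"
  shows "mult_degree_kirchhoff_index (with_proj (crossed_chain n))
     - gutman_index (with_proj (crossed_chain n)) / 4 \<in> {0..25 / 2 * real (n + 1) ^ 2}"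
proof -
  let ?G = "with_proj (crossed_chain n)"
  let ?V = "{1..n + 1} \<times> (UNIV :: bool set)"
  let ?S = "{(u, v). u \<in> ?V \<and> v \<in> ?V \<and> u \<noteq> v}"
  let ?d = "\<lambda>u v. real (out_degree ?G u) * real (out_degree ?G v)"
  let ?r = "\<lambda>u v. effective_resistance ?G u v - graph_dist ?G u v / 4"
  have gut: "gutman_index ?G = (\<Sum>(u, v) \<in> ?S. ?d u v * graph_dist ?G u v) / 2"
    by (rule gutman_index_crossed_chain_eq)
  have "mult_degree_kirchhoff_index ?G = (\<Sum>(u, v) \<in> ?S. ?d u v * effective_resistance ?G u v) / 2"
    unfolding mult_degree_kirchhoff_index_def with_proj_simps pverts_crossed_chain
    by (rule sum_upairs_eq_half_sum)
      (auto simp: effective_resistance_crossed_chain_commute)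
  then have diff: "mult_degree_kirchhoff_index ?G - gutman_index ?G / 4
      = (\<Sum>(u, v) \<in> ?S. ?d u v * ?r u v) / 2"
    unfolding gut
    by (simp add: case_prod_unfold right_diff_distrib sum_subtractf sum_divide_distrib diff_divide_distrib)
  have fin: "finite ?S"
    by (rule finite_subset[of _ "?V \<times> ?V"]) auto
  have "card ?S \<le> card (?V \<times> ?V)"
    by (rule card_mono) auto
  then have card: "real (card ?S) \<le> 4 * real (n + 1) ^ 2"
    by (simp only: card_cartesian_product card_UNIV_bool card_atLeastAtMost of_nat_le_iff[symmetric, where 'a = real])
      (simp add: power2_eq_square algebra_simps)
  have term_bounds: "0 \<le> ?d u v * ?r u v \<and> ?d u v * ?r u v \<le> 25 / 4" if "(u, v) \<in> ?S" for u v
  proof -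
    have uv: "u \<in> ?V" "v \<in> ?V" "u \<noteq> v" using that by auto
    have "?d u v \<le> 5 * 5"
      using out_degree_crossed_chain_bounds[OF assms uv(1)]
        out_degree_crossed_chain_bounds[OF assms uv(2)] by (intro mult_mono) auto
    then have "?d u v * ?r u v \<le> (5 * 5) * (1 / 4)"
      using effective_resistance_crossed_chain_bounds[OF assms uv]
      by (intro mult_mono[of "?d u v" "5 * 5" "?r u v"]) auto
    then show ?thesis
      using effective_resistance_crossed_chain_bounds[OF assms uv] by simp
  qed
  have "(\<Sum>(u, v) \<in> ?S. ?d u v * ?r u v) \<le> (\<Sum>x \<in> ?S. 25 / 4)"
    using term_bounds by (intro sum_mono) auto
  also have "\<dots> \<le> 25 * real (n + 1) ^ 2"
    using card by simp
  finally have "(\<Sum>(u, v) \<in> ?S. ?d u v * ?r u v) \<le> 25 * real (n + 1) ^ 2" .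
  moreover have "(\<Sum>(u, v) \<in> ?S. ?d u v * ?r u v) \<ge> 0"
    using term_bounds by (intro sum_nonneg) auto
  ultimately show ?thesis unfolding diff by simp
qed

theorem theorem3p6:
  shows "(\<lambda>n. mult_degree_kirchhoff_index (with_proj (crossed_chain n)) /
              gutman_index (with_proj (crossed_chain n))) \<longlonglongrightarrow> 1 / 4"
proof (rule tendsto_sandwich)
  let ?K = "\<lambda>n. mult_degree_kirchhoff_index (with_proj (crossed_chain n))"
  let ?G = "\<lambda>n. gutman_index (with_proj (crossed_chain n))"
  let ?g = "\<lambda>n. 6 * (real (n + 1) ^ 3 - real (n + 1))"
  \<comment> \<open>The restriction to \<open>n >= 1\<close> makes \<open>?g n\<close> positive; it
    vanishes at \<open>n = 0\<close>.\<close>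
  have bounds: "1 / 4 \<le> ?K n / ?G n \<and> ?K n / ?G n \<le> 1 / 4 + 25 / 2 * real (n + 1) ^ 2 / ?g n"
    if n: "n \<ge> 1" for n
  proof -
    have g: "?g n > 0"
      using n by (simp add: power3_eq_cube algebra_simps add_pos_nonneg)
    have G: "?G n \<ge> ?g n" by (rule gutman_index_crossed_chain_ge[OF n])
    have K: "?K n - ?G n / 4 \<ge> 0" "?K n - ?G n / 4 \<le> 25 / 2 * real (n + 1) ^ 2"
      using mult_degree_kirchhoff_index_crossed_chain_bounds[OF n] by auto
    have "?K n / ?G n - 1 / 4 = (?K n - ?G n / 4) / ?G n"
      using g G by (simp add: field_simps)
    moreover have "(?K n - ?G n / 4) / ?G n \<le> 25 / 2 * real (n + 1) ^ 2 / ?g n"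
      using g G K by (intro frac_le) auto
    moreover have "(?K n - ?G n / 4) / ?G n \<ge> 0"
      using g G K by (intro divide_nonneg_pos) auto
    ultimately show ?thesis by linarith
  qed
  show "\<forall>\<^sub>F n in sequentially. 1 / 4 \<le> ?K n / ?G n"
    using bounds by (auto simp: eventually_sequentially)
  show "\<forall>\<^sub>F n in sequentially. ?K n / ?G n \<le> 1 / 4 + 25 / 2 * real (n + 1) ^ 2 / ?g n"
    using bounds by (auto simp: eventually_sequentially)
  show "(\<lambda>n. 1 / 4 + 25 / 2 * real (n + 1) ^ 2 / ?g n) \<longlonglongrightarrow> 1 / 4"
    by real_asymp
qed simp

end
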